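(* Fix a parent cell $\widehat K$, a geometry map $X=(X_1,X_2,X_3):\widehat K\to\mathbb R^3$, a cubature error functional $\mathcal L$, and scalar basis functions $\phi_1,\dots,\phi_d$ as in the context. The $3\times3$ matrix $\mathsf S_X$ is positive semidefinite, and for every $R\in\mathbb R^{3\times3}$ $$\|\mathsf E_R\|_F^2=2\operatorname{tr}(R\,\mathsf S_X R^T),\qquad \|\mathsf E_{I_3}\|_F^2=2\operatorname{tr}\mathsf S_X .$$ These identities hold for the fixed rule and basis without any positivity or exactness assumption on the rule.
   Context: $\mathcal L[f]=\mathcal Q[f]-\int_{\widehat K}f\,d\xi$, where $\mathcal Q[f]=\sum_q w_q f(\xi_q)$ is a fixed finite cubature rule on the parent cell. $D_\xi$ is the derivative in parent coordinates (Jacobian rows are vector components). For $A,B\in\mathbb R^{3\times3}$: $A:B=\operatorname{tr}(A^TB)$, $\operatorname{cof}A$ is the matrix of signed $2\times2$ minors, $A\times B=\operatorname{cof}(A+B)-\operatorname{cof}A-\operatorname{cof}B$. $\times_{\mathbb R^3}$ is the usual vector cross product, $\|\cdot\|_F$ the Frobenius norm and $\langle A,B\rangle_F=\operatorname{tr}(A^TB)$. For a scalar field $f$ on $\widehat K$ let $\mathsf B(f)\in\mathbb R^{d\times d}$ be the skew-symmetric matrix $\mathsf B(f)_{ab}=\mathcal L[D_\xi f\cdot(D_\xi\phi_a\times_{\mathbb R^3}D_\xi\phi_b)]$. The same scalar basis is used for each of the three physical components of the vector variations; $\mathsf E_R\in\mathbb R^{3d\times3d}$ is the matrix, in the resulting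 vector basis $\{\phi_a e_i\}$, of the symmetric bilinear form $(u,v)\mapsto\mathcal L[D_\xi(RX):(D_\xi u\times D_\xi v)]$. The Gram matrix is $(\mathsf S_X)_{ij}=\langle\mathsf B(X_i),\mathsf B(X_j)\rangle_F$, $i,j\in\{1,2,3\}$. *)

theory Defs
  imports "HOL-Analysis.Analysis"
begin

definition parent_cell :: "(real^3) set \<Rightarrow> bool" where
  "parent_cell K \<longleftrightarrow> compact K \<and> convex K \<and> interior K \<noteq> {}"

definition cubature_error ::
  "(real^3) set \<Rightarrow> 'q set \<Rightarrow> ('q \<Rightarrow> real) \<Rightarrow> ('q \<Rightarrow> real^3) \<Rightarrow> (real^3 \<Rightarrow> real) \<Rightarrow> real" where
  "cubature_error K Q w node f = (\<Sum>q\<in>Q. w q * f (node q)) - (LINT \<xi>:K|lebesgue. f \<xi>)"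

text \<open>
  Fields live on the cell, so all derivatives are taken within K; on a convex set with
  nonempty interior they are unique also at boundary points.
\<close>

definition grad_in :: "(real^3) set \<Rightarrow> (real^3 \<Rightarrow> real) \<Rightarrow> real^3 \<Rightarrow> real^3" where
  "grad_in K f \<xi> = (\<chi> j. frechet_derivative f (at \<xi> within K) (axis j 1))"

definition jac_in :: "(real^3) set \<Rightarrow> (real^3 \<Rightarrow> real^3) \<Rightarrow> real^3 \<Rightarrow> real^3^3" where
  "jac_in K u \<xi> = jacobian u (at \<xi> within K)"

definition frob_inner :: "real^'n^'m \<Rightarrow> real^'n^'m \<Rightarrow> real" where
  "frob_inner A B = trace (transpose A ** B)"

definition frob_norm :: "real^'n^'m \<Rightarrow> real" where
  "frob_norm A = sqrt (frob_inner A A)"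

definition cof :: "real^3^3 \<Rightarrow> real^3^3" where
  "cof A = vector
    [vector [  A$2$2 * A$3$3 - A$2$3 * A$3$2,
             -(A$2$1 * A$3$3 - A$2$3 * A$3$1),
               A$2$1 * A$3$2 - A$2$2 * A$3$1],
     vector [-(A$1$2 * A$3$3 - A$1$3 * A$3$2),
               A$1$1 * A$3$3 - A$1$3 * A$3$1,
             -(A$1$1 * A$3$2 - A$1$2 * A$3$1)],
     vector [  A$1$2 * A$2$3 - A$1$3 * A$2$2,
             -(A$1$1 * A$2$3 - A$1$3 * A$2$1),
               A$1$1 * A$2$2 - A$1$2 * A$2$1]]"

definition mat_cross :: "real^3^3 \<Rightarrow> real^3^3 \<Rightarrow> real^3^3" where
  "mat_cross A B = cof (A + B) - cof A - cof B"

definition triple_field ::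
  "(real^3) set \<Rightarrow> (real^3 \<Rightarrow> real) \<Rightarrow> (real^3 \<Rightarrow> real) \<Rightarrow> (real^3 \<Rightarrow> real) \<Rightarrow> real^3 \<Rightarrow> real" where
  "triple_field K f g h \<xi> = grad_in K f \<xi> \<bullet> cross3 (grad_in K g \<xi>) (grad_in K h \<xi>)"

definition B_mat ::
  "(real^3) set \<Rightarrow> ((real^3 \<Rightarrow> real) \<Rightarrow> real) \<Rightarrow> ('d::finite \<Rightarrow> real^3 \<Rightarrow> real) \<Rightarrow> (real^3 \<Rightarrow> real) \<Rightarrow> real^'d^'d" where
  "B_mat K L \<phi> f = (\<chi> a b. L (triple_field K f (\<phi> a) (\<phi> b)))"

definition S_mat ::
  "(real^3) set \<Rightarrow> ((real^3 \<Rightarrow> real) \<Rightarrow> real) \<Rightarrow> ('d::finite \<Rightarrow> real^3 \<Rightarrow> real) \<Rightarrow> (real^3 \<Rightarrow> real^3)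
    \<Rightarrow> real^3^3" where
  "S_mat K L \<phi> X =
    (\<chi> i j. frob_inner (B_mat K L \<phi> (\<lambda>\<xi>. X \<xi> $ i)) (B_mat K L \<phi> (\<lambda>\<xi>. X \<xi> $ j)))"

definition E_form ::
  "(real^3) set \<Rightarrow> ((real^3 \<Rightarrow> real) \<Rightarrow> real) \<Rightarrow> (real^3 \<Rightarrow> real^3) \<Rightarrow> real^3^3
    \<Rightarrow> (real^3 \<Rightarrow> real^3) \<Rightarrow> (real^3 \<Rightarrow> real^3) \<Rightarrow> real" where
  "E_form K L X R u v =
    L (\<lambda>\<xi>. frob_inner (jac_in K (\<lambda>\<eta>. R *v X \<eta>) \<xi>) (mat_cross (jac_in K u \<xi>) (jac_in K v \<xi>)))"

definition vec_basis :: "('d \<Rightarrow> real^3 \<Rightarrow> real) \<Rightarrow> 'd \<times> 3 \<Rightarrow> real^3 \<Rightarrow> real^3" where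
  "vec_basis \<phi> p \<xi> = \<phi> (fst p) \<xi> *\<^sub>R axis (snd p) 1"

definition E_mat ::
  "(real^3) set \<Rightarrow> ((real^3 \<Rightarrow> real) \<Rightarrow> real) \<Rightarrow> ('d::finite \<Rightarrow> real^3 \<Rightarrow> real) \<Rightarrow> (real^3 \<Rightarrow> real^3)
    \<Rightarrow> real^3^3 \<Rightarrow> real^('d \<times> 3)^('d \<times> 3)" where
  "E_mat K L \<phi> X R = (\<chi> p q. E_form K L X R (vec_basis \<phi> p) (vec_basis \<phi> q))"

definition lin_indep_on :: "'x set \<Rightarrow> ('d::finite \<Rightarrow> 'x \<Rightarrow> real) \<Rightarrow> bool" where
  "lin_indep_on K \<phi> \<longleftrightarrow>
    (\<forall>c. (\<forall>\<xi>\<in>K. (\<Sum>a\<in>UNIV. c a * \<phi> a \<xi>) = 0) \<longrightarrow> (\<forall>a. c a = 0))"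

definition pos_semidef :: "real^'n^'n \<Rightarrow> bool" where
  "pos_semidef A \<longleftrightarrow> transpose A = A \<and> (\<forall>v. 0 \<le> v \<bullet> (A *v v))"

text \<open>
  The integrability needed for the exact integral in the cubature error to exist is automatic
  for fields that are continuously differentiable on the cell.
\<close>

lemma triple_field_integrable:
  assumes "parent_cell K" "continuous_on K (grad_in K f)" "continuous_on K (grad_in K g)"
    "continuous_on K (grad_in K h)"
  shows "set_integrable lebesgue K (triple_field K f g h)"
proof -
  have "continuous_on K (triple_field K f g h)"
    unfolding triple_field_def by (intro continuous_intros continuous_on_cross assms)
  then have "integrable lborel (\<lambda>x. indicator K x *\<^sub>R triple_field K f g h x)"
    using assms(1) borel_integrable_compact parent_cell_def by blast
  then show ?thesis
    unfolding set_integrable_def using integrable_completion by blast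
qed

end

theory Submission
  imports Defs
begin

text \<open>
  On the cell the Jacobian rows of a vector field are the gradients of its components, so the
  vector basis function \<open>\<phi>\<^sub>a e\<^sub>i\<close> has the rank-one Jacobian \<open>e\<^sub>i \<otimes> D\<phi>\<^sub>a\<close>, and
  \<open>(e\<^sub>i \<otimes> g) \<times> (e\<^sub>k \<otimes> h) = (e\<^sub>i \<times> e\<^sub>k) \<otimes> (g \<times> h)\<close>. Writing \<open>b\<^sub>a\<^sub>b \<in> \<real>\<^sup>3\<close> for the vector with
  components \<open>B(X\<^sub>j)\<^sub>a\<^sub>b\<close>, linearity of the error functional gives the entries
  \<open>(e\<^sub>i \<times> e\<^sub>k) \<bullet> R b\<^sub>a\<^sub>b\<close> of \<open>E\<^sub>R\<close>. The squares of these sum over \<open>i, k\<close> to \<open>2 |R b\<^sub>a\<^sub>b|\<^sup>2\<close>, while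
  \<open>S\<^sub>X\<close> is the sum over \<open>a, b\<close> of \<open>b\<^sub>a\<^sub>b \<otimes> b\<^sub>a\<^sub>b\<close>.
\<close>

section \<open>Uniqueness and calculus of derivatives within the cell\<close>

lemma has_derivative_unique_within_convex:
  fixes f :: "'a::euclidean_space \<Rightarrow> 'b::real_normed_vector"
  assumes "convex S" and "interior S \<noteq> {}" and "x \<in> S"
    and D: "(f has_derivative D) (at x within S)"
    and D': "(f has_derivative D') (at x within S)"
  shows "D = D'"
proof -
  \<comment> \<open>The difference \<open>E\<close> is a derivative of the zero function. It
    vanishes along segments from \<open>x\<close> into \<open>S\<close>, hence by linearity on
    differences of points of \<open>S\<close>; a ball inside \<open>S\<close> provides such
    differences in every direction, even when \<open>x\<close> is a boundary point.\<close>
  define E where "E = (\<lambda>h. D h - D' h)"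
  have E: "((\<lambda>y. 0) has_derivative E) (at x within S)"
    using has_derivative_diff[OF D D'] by (simp add: E_def)
  interpret E: linear E
    using E has_derivative_linear by blast
  have to_S: "E (y - x) = 0" if "y \<in> S" for y
  proof -
    \<comment> \<open>Restriction to the segment from \<open>x\<close> to \<open>y\<close> leaves a
      one-variable problem on [0,1], where the one-sided derivative at 0 is unique.\<close>
    define g where "g = (\<lambda>t::real. x + t *\<^sub>R (y - x))"
    have g: "(g has_derivative (\<lambda>t. t *\<^sub>R (y - x))) (at 0 within cbox 0 1)"
      unfolding g_def by (auto intro!: derivative_eq_intros)
    have "g t \<in> S" if "t \<in> cbox 0 1" for t
      using convexD_alt[OF assms(1) \<open>x \<in> S\<close> \<open>y \<in> S\<close>, of t] that
      by (simp add: g_def algebra_simps)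
    then have img: "g ` cbox 0 1 \<subseteq> S"
      by blast
    have "((\<lambda>y. 0) has_derivative E) (at (g 0) within g ` cbox 0 1)"
      using has_derivative_subset[OF E img] by (simp add: g_def)
    from has_derivative_in_compose[OF g this]
    have "((\<lambda>t. 0) has_derivative (\<lambda>t. E (t *\<^sub>R (y - x)))) (at 0 within cbox (0::real) 1)" .
    moreover have "((\<lambda>t. 0) has_derivative (\<lambda>t. 0::'b)) (at 0 within cbox (0::real) 1)"
      by simp
    ultimately have "(\<lambda>t. E (t *\<^sub>R (y - x))) = (\<lambda>t::real. 0)"
      by (rule frechet_derivative_unique_within_closed_interval[rotated 2]) auto
    from fun_cong[OF this, of 1] show ?thesis
      by simp
  qed
  obtain z e where "e > 0" and ball: "ball z e \<subseteq> S"
    using \<open>interior S \<noteq> {}\<close> by (auto simp: mem_interior)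
  have zero: "E h = 0" for h
  proof (cases "h = 0")
    case False
    \<comment> \<open>The factor 2 keeps \<open>z + t *\<^sub>R h\<close> inside the open ball
      around \<open>z\<close>, so \<open>t *\<^sub>R h\<close> is a difference of two points of
      \<open>S\<close>.\<close>
    define t where "t = e / (2 * norm h)"
    have "t > 0" and "t * norm h < e"
      using \<open>e > 0\<close> False by (auto simp: t_def)
    then have "z + t *\<^sub>R h \<in> S" and "z \<in> S"
      using \<open>e > 0\<close> ball by (auto simp: subset_iff dist_norm)
    then have "E ((z + t *\<^sub>R h - x) - (z - x)) = 0"
      using to_S by (simp only: E.diff diff_self)
    then have "t *\<^sub>R E h = 0"
      by (simp add: E.scale)
    then show ?thesis
      using \<open>t > 0\<close> by simp
  qed (simp add: E.zero)
  then show ?thesis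
    by (auto simp: E_def fun_eq_iff)
qed

text \<open>\<open>frechet_derivative\<close> is a choice among derivatives. Uniqueness on the cell
  forces it to agree with any derivative computed by the usual rules, at boundary points as
  well.\<close>

lemma frechet_derivative_within_cell:
  assumes "parent_cell K" and "x \<in> K" and "(f has_derivative D) (at x within K)"
  shows "frechet_derivative f (at x within K) = D"
proof -
  have "(f has_derivative frechet_derivative f (at x within K)) (at x within K)"
    using assms(3) by (auto simp: frechet_derivative_works[symmetric] differentiable_def)
  then show ?thesis
    using assms has_derivative_unique_within_convex unfolding parent_cell_def by blast
qed

lemma grad_in_has_derivative:
  assumes "parent_cell K" and "x \<in> K" and "(f has_derivative D) (at x within K)"
  shows "grad_in K f x = (\<chi> j. D (axis j 1))"
  by (simp add: grad_in_def frechet_derivative_within_cell[OF assms])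

lemma jac_in_nth:
  assumes "parent_cell K" and "x \<in> K" and "u differentiable (at x within K)"
  shows "jac_in K u x $ i = grad_in K (\<lambda>y. u y $ i) x"
proof -
  let ?D = "frechet_derivative u (at x within K)"
  have "(u has_derivative ?D) (at x within K)"
    using assms(3) frechet_derivative_works by blast
  then have "((\<lambda>y. u y $ i) has_derivative (\<lambda>h. ?D h $ i)) (at x within K)"
    by (rule bounded_linear.has_derivative[OF bounded_linear_vec_nth])
  then show ?thesis
    using grad_in_has_derivative[OF assms(1,2)]
    by (simp add: jac_in_def jacobian_def matrix_def)
qed

lemma grad_in_sum_scaled:
  fixes f :: "'j::finite \<Rightarrow> real^3 \<Rightarrow> real"
  assumes "parent_cell K" and "x \<in> K" and "\<And>j. f j differentiable (at x within K)"
  shows "grad_in K (\<lambda>y. \<Sum>j\<in>UNIV. c j * f j y) x = (\<Sum>j\<in>UNIV. c j *\<^sub>R grad_in K (f j) x)"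
proof -
  have d: "(f j has_derivative frechet_derivative (f j) (at x within K)) (at x within K)" for j
    using assms(3) frechet_derivative_works by blast
  have "((\<lambda>y. \<Sum>j\<in>UNIV. c j * f j y) has_derivative
      (\<lambda>h. \<Sum>j\<in>UNIV. c j * frechet_derivative (f j) (at x within K) h)) (at x within K)"
    by (intro has_derivative_sum has_derivative_mult_right d)
  from grad_in_has_derivative[OF assms(1,2) this] show ?thesis
    by (simp add: vec_eq_iff grad_in_def)
qed

lemma differentiable_matrix_vector_mult:
  fixes X :: "'a::real_normed_vector \<Rightarrow> real^'n"
  assumes "X differentiable F"
  shows "(\<lambda>y. (R::real^'n^'m) *v X y) differentiable F"
  using assms bounded_linear.has_derivative[OF matrix_vector_mul_bounded_linear]
  unfolding differentiable_def by blast

lemma jac_in_matrix_vector_mult_nth: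
  assumes "parent_cell K" and "x \<in> K" and X: "X differentiable (at x within K)"
  shows "jac_in K (\<lambda>y. R *v X y) x $ m = (\<Sum>j\<in>UNIV. R $ m $ j *\<^sub>R grad_in K (\<lambda>y. X y $ j) x)"
proof -
  have "(\<lambda>y. X y $ j) differentiable (at x within K)" for j
    using X bounded_linear.has_derivative[OF bounded_linear_vec_nth]
    unfolding differentiable_def by blast
  from grad_in_sum_scaled[OF assms(1,2), of "\<lambda>j y. X y $ j" "\<lambda>j. R $ m $ j", OF this]
  show ?thesis
    unfolding jac_in_nth[OF assms(1,2) differentiable_matrix_vector_mult[OF X]]
    by (simp add: matrix_vector_mult_def)
qed

lemma jac_in_vec_basis:
  assumes "parent_cell K" and "x \<in> K" and "\<phi> a differentiable (at x within K)"
  shows "jac_in K (vec_basis \<phi> (a, i)) x = axis i (grad_in K (\<phi> a) x)"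
proof -
  let ?D = "frechet_derivative (\<phi> a) (at x within K)"
  have "(\<phi> a has_derivative ?D) (at x within K)"
    using assms(3) frechet_derivative_works by blast
  then have "(vec_basis \<phi> (a, i) has_derivative (\<lambda>h. ?D h *\<^sub>R axis i 1)) (at x within K)"
    unfolding vec_basis_def by (auto intro!: derivative_eq_intros)
  from frechet_derivative_within_cell[OF assms(1,2) this] show ?thesis
    by (simp add: jac_in_def jacobian_def matrix_def grad_in_def vec_eq_iff axis_def)
qed

section \<open>Cross product and Frobenius identities\<close>

lemma mat_cross_axis_nth:
  "mat_cross (axis i g) (axis k h) $ m = (cross3 (axis i 1) (axis k 1) $ m) *\<^sub>R cross3 g h"
proof -
  have "\<forall>i k m. mat_cross (axis i g) (axis k h) $ m
      = (cross3 (axis i 1) (axis k 1) $ m) *\<^sub>R cross3 g h"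
    \<comment> \<open>A matrix with a single nonzero row has zero cofactor matrix, so only the
      minors of the sum that mix \<open>g\<close> and \<open>h\<close> survive; for
      \<open>i = k\<close> both sides vanish. The 27 index triples are checked in turn.\<close>
    by (simp add: forall_3 mat_cross_def cof_def cross3_def axis_def vec_eq_iff)
  then show ?thesis
    by blast
qed

text \<open>Each axis vector arises, up to sign, as the cross product of exactly two ordered pairs
  of axis vectors. This is the origin of the factor 2 in the norm identity.\<close>

lemma sum_cross_axis_inner_squared:
  "(\<Sum>i\<in>UNIV. \<Sum>k\<in>UNIV. (cross3 (axis i 1) (axis k 1) \<bullet> v)\<^sup>2) = 2 * (v \<bullet> v)"
  by (simp add: sum_3 inner_vec_def cross3_def axis_def power2_eq_square)

lemma frob_inner_eq_sum: "frob_inner A B = (\<Sum>i\<in>UNIV. \<Sum>j\<in>UNIV. A $ i $ j * B $ i $ j)"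
  unfolding frob_inner_def trace_def matrix_matrix_mult_def transpose_def
  by (simp, rule sum.swap)

lemma frob_inner_eq_inner: "frob_inner A B = A \<bullet> B"
  by (simp add: frob_inner_eq_sum inner_vec_def)

lemma frob_norm_squared: "(frob_norm A)\<^sup>2 = (\<Sum>i\<in>UNIV. \<Sum>j\<in>UNIV. (A $ i $ j)\<^sup>2)"
proof -
  have "frob_inner A A \<ge> 0"
    by (simp add: frob_inner_eq_inner)
  then show ?thesis
    unfolding frob_norm_def by (simp add: frob_inner_eq_sum power2_eq_square)
qed

section \<open>Locality and linearity of the cubature error\<close>

lemma cubature_error_cong:
  assumes "K \<in> sets lebesgue" and "\<And>q. q \<in> Q \<Longrightarrow> node q \<in> K" and "\<And>x. x \<in> K \<Longrightarrow> f x = g x"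
  shows "cubature_error K Q w node f = cubature_error K Q w node g"
proof -
  have "(LINT x:K|lebesgue. f x) = (LINT x:K|lebesgue. g x)"
    using assms(1,3) by (intro set_lebesgue_integral_cong) auto
  then show ?thesis
    using assms(2,3) by (simp add: cubature_error_def)
qed

text \<open>Integrability of every summand allows the finite sum to be exchanged with the integral;
  a non-integrable function has integral 0 by convention, so additivity could fail without
  it.\<close>

lemma cubature_error_sum_scaled:
  fixes f :: "'j::finite \<Rightarrow> real^3 \<Rightarrow> real"
  assumes "\<And>j. set_integrable lebesgue K (f j)"
  shows "cubature_error K Q w node (\<lambda>x. \<Sum>j\<in>UNIV. c j * f j x)
    = (\<Sum>j\<in>UNIV. c j * cubature_error K Q w node (f j))"
proof -
  have "(LINT x:K|lebesgue. (\<Sum>j\<in>UNIV. c j * f j x)) = (\<Sum>j\<in>UNIV. LINT x:K|lebesgue. c j * f j x)"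
    using assms unfolding set_lebesgue_integral_def set_integrable_def scaleR_sum_right
    by (subst Bochner_Integration.integral_sum) (simp_all add: mult.left_commute)
  moreover have "(\<Sum>q\<in>Q. w q * (\<Sum>j\<in>UNIV. c j * f j (node q)))
      = (\<Sum>j\<in>UNIV. c j * (\<Sum>q\<in>Q. w q * f j (node q)))"
    unfolding sum_distrib_left by (subst sum.swap) (simp add: mult.left_commute)
  ultimately show ?thesis
    by (simp add: cubature_error_def right_diff_distrib sum_subtractf)
qed

section \<open>Matrix entries expressed through \<open>B_vec\<close>, the vectors
  \<open>b\<^sub>a\<^sub>b\<close> of the overview\<close>

definition B_vec ::
  "(real^3) set \<Rightarrow> ((real^3 \<Rightarrow> real) \<Rightarrow> real) \<Rightarrow> ('d::finite \<Rightarrow> real^3 \<Rightarrow> real) \<Rightarrow> (real^3 \<Rightarrow> real^3)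
    \<Rightarrow> 'd \<Rightarrow> 'd \<Rightarrow> real^3" where
  "B_vec K L \<phi> X a b = (\<chi> j. B_mat K L \<phi> (\<lambda>\<xi>. X \<xi> $ j) $ a $ b)"

text \<open>Transposing \<open>R\<close> onto the cross product of axis vectors separates the
  integrand into coefficients independent of \<open>x\<close> and triple fields, the form to which
  linearity of the cubature error applies.\<close>

lemma E_integrand_vec_basis:
  assumes "parent_cell K" and "x \<in> K" and "X differentiable (at x within K)"
    and "\<And>a. \<phi> a differentiable (at x within K)"
  shows "frob_inner (jac_in K (\<lambda>\<eta>. R *v X \<eta>) x)
      (mat_cross (jac_in K (vec_basis \<phi> (a, i)) x) (jac_in K (vec_basis \<phi> (b, k)) x))
    = (\<Sum>j\<in>UNIV. (cross3 (axis i 1) (axis k 1) v* R) $ j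
        * triple_field K (\<lambda>\<xi>. X \<xi> $ j) (\<phi> a) (\<phi> b) x)"
    (is "?lhs = ?rhs")
proof -
  let ?e = "cross3 (axis i 1) (axis k 1) :: real^3"
  let ?c = "cross3 (grad_in K (\<phi> a) x) (grad_in K (\<phi> b) x)"
  have "?lhs = (\<Sum>m\<in>UNIV. (\<Sum>j\<in>UNIV. R $ m $ j *\<^sub>R grad_in K (\<lambda>y. X y $ j) x) \<bullet> (?e $ m *\<^sub>R ?c))"
    unfolding frob_inner_eq_inner inner_vec_def[of "jac_in K (\<lambda>\<eta>. R *v X \<eta>) x"]
    by (simp add: jac_in_matrix_vector_mult_nth jac_in_vec_basis mat_cross_axis_nth assms)
  also have "\<dots> = (\<Sum>m\<in>UNIV. \<Sum>j\<in>UNIV. R $ m $ j * ?e $ m * (grad_in K (\<lambda>y. X y $ j) x \<bullet> ?c))"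
    by (simp add: inner_sum_left sum_distrib_left mult_ac)
  also have "\<dots> = ?rhs"
    unfolding vector_matrix_mult_def triple_field_def
    by (subst sum.swap) (simp add: sum_distrib_right mult.commute)
  finally show ?thesis .
qed

lemma E_mat_entry:
  assumes cell: "parent_cell K"
    and node: "\<forall>q\<in>Q. node q \<in> K"
    and L: "L = cubature_error K Q w node"
    and X: "X differentiable_on K" and \<phi>: "\<forall>a. \<phi> a differentiable_on K"
    and int: "\<forall>i a b. set_integrable lebesgue K (triple_field K (\<lambda>\<xi>. X \<xi> $ i) (\<phi> a) (\<phi> b))"
  shows "E_mat K L \<phi> X R $ (a, i) $ (b, k)
    = cross3 (axis i 1) (axis k 1) \<bullet> (R *v B_vec K L \<phi> X a b)"
proof -
  let ?c = "cross3 (axis i 1) (axis k 1) v* R"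
  have "K \<in> sets lebesgue"
    using cell by (simp add: parent_cell_def borel_compact sets_completionI_sets)
  \<comment> \<open>The pointwise formula is available only on \<open>K\<close>. This suffices
    because the nodes lie in \<open>K\<close> and the exact integral is taken over
    \<open>K\<close>.\<close>
  then have "E_mat K L \<phi> X R $ (a, i) $ (b, k)
      = L (\<lambda>x. \<Sum>j\<in>UNIV. ?c $ j * triple_field K (\<lambda>\<xi>. X \<xi> $ j) (\<phi> a) (\<phi> b) x)"
    unfolding E_mat_def E_form_def L using node X \<phi>
    by (simp, intro cubature_error_cong)
      (auto intro!: E_integrand_vec_basis cell simp: differentiable_on_def)
  also have "\<dots> = (\<Sum>j\<in>UNIV. ?c $ j * L (triple_field K (\<lambda>\<xi>. X \<xi> $ j) (\<phi> a) (\<phi> b)))"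
    unfolding L by (intro cubature_error_sum_scaled) (use int in blast)
  also have "\<dots> = ?c \<bullet> B_vec K L \<phi> X a b"
    by (simp add: inner_vec_def B_vec_def B_mat_def)
  finally show ?thesis
    by (simp add: dot_lmul_matrix)
qed

lemma S_mat_entry:
  "S_mat K L \<phi> X $ i $ j = (\<Sum>a\<in>UNIV. \<Sum>b\<in>UNIV. B_vec K L \<phi> X a b $ i * B_vec K L \<phi> X a b $ j)"
  by (simp add: S_mat_def frob_inner_eq_sum B_vec_def)

text \<open>A Gram matrix has a sum of squares as its quadratic form. For arbitrary \<open>v\<close>
  this gives semidefiniteness; for \<open>v\<close> running through the rows of \<open>R\<close> it
  gives the trace of the conjugated matrix.\<close>

lemma S_mat_quadratic_form:
  "v \<bullet> (S_mat K L \<phi> X *v v) = (\<Sum>a\<in>UNIV. \<Sum>b\<in>UNIV. (v \<bullet> B_vec K L \<phi> X a b)\<^sup>2)"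
  by (simp add: inner_vec_def matrix_vector_mult_def S_mat_entry sum_3 power2_eq_square
      sum_distrib_left sum_distrib_right sum.distrib algebra_simps)

lemma pos_semidef_S_mat: "pos_semidef (S_mat K L \<phi> X)"
proof -
  have "transpose (S_mat K L \<phi> X) = S_mat K L \<phi> X"
    by (simp add: vec_eq_iff transpose_def S_mat_entry mult.commute)
  then show ?thesis
    by (simp add: pos_semidef_def S_mat_quadratic_form sum_nonneg)
qed

lemma trace_conjugate:
  fixes R :: "real^'n^'m"
  shows "trace (R ** S ** transpose R) = (\<Sum>m\<in>UNIV. R $ m \<bullet> (S *v R $ m))"
  unfolding trace_def matrix_mul_assoc[symmetric]
  by (simp add: matrix_matrix_mult_def matrix_vector_mult_def transpose_def inner_vec_def)

lemma trace_conjugate_S_mat: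
  fixes R :: "real^3^3"
  shows "trace (R ** S_mat K L \<phi> X ** transpose R)
    = (\<Sum>a\<in>UNIV. \<Sum>b\<in>UNIV. (R *v B_vec K L \<phi> X a b) \<bullet> (R *v B_vec K L \<phi> X a b))"
  by (simp add: trace_conjugate S_mat_quadratic_form inner_vec_def[of "R *v _"]
      matrix_vector_mul_component sum_3 sum.distrib power2_eq_square)

theorem proposition10:
  fixes K :: "(real^3) set"
    and Q :: "'q set" and w :: "'q \<Rightarrow> real" and node :: "'q \<Rightarrow> real^3"
    and L :: "(real^3 \<Rightarrow> real) \<Rightarrow> real"
    and X :: "real^3 \<Rightarrow> real^3"
    and \<phi> :: "'d::finite \<Rightarrow> real^3 \<Rightarrow> real"
  assumes "parent_cell K"
    and "finite Q" and "\<forall>q\<in>Q. node q \<in> K"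
    and "L = cubature_error K Q w node"
    and "X differentiable_on K"
    and "\<forall>a. \<phi> a differentiable_on K"
    and "lin_indep_on K \<phi>"
    and "\<forall>i a b. set_integrable lebesgue K (triple_field K (\<lambda>\<xi>. X \<xi> $ i) (\<phi> a) (\<phi> b))"
  shows "pos_semidef (S_mat K L \<phi> X) \<and>
    (\<forall>R :: real^3^3.
      (frob_norm (E_mat K L \<phi> X R))\<^sup>2 = 2 * trace (R ** S_mat K L \<phi> X ** transpose R)) \<and>
    (frob_norm (E_mat K L \<phi> X (mat 1)))\<^sup>2 = 2 * trace (S_mat K L \<phi> X)"
proof -
  have main: "(frob_norm (E_mat K L \<phi> X R))\<^sup>2 = 2 * trace (R ** S_mat K L \<phi> X ** transpose R)"
    for R :: "real^3^3"
  proof -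
    let ?f = "\<lambda>a i b k. (cross3 (axis i 1) (axis k 1) \<bullet> (R *v B_vec K L \<phi> X a b))\<^sup>2"
    have "(frob_norm (E_mat K L \<phi> X R))\<^sup>2 = (\<Sum>(a,i)\<in>UNIV \<times> UNIV. \<Sum>(b,k)\<in>UNIV \<times> UNIV. ?f a i b k)"
      unfolding frob_norm_squared UNIV_Times_UNIV
      by (simp add: split_def flip: E_mat_entry[OF assms(1,3-6,8)])
    also have "\<dots> = (\<Sum>a\<in>UNIV. \<Sum>i\<in>UNIV. \<Sum>b\<in>UNIV. \<Sum>k\<in>UNIV. ?f a i b k)"
      by (simp only: sum.cartesian_product[symmetric])
    \<comment> \<open>With the component indices innermost, each pair \<open>a\<close>,
      \<open>b\<close> contributes a complete sum over axis pairs for one fixed vector.\<close>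
    also have "\<dots> = (\<Sum>a\<in>UNIV. \<Sum>b\<in>UNIV. \<Sum>i\<in>UNIV. \<Sum>k\<in>UNIV. ?f a i b k)"
      by (intro sum.cong refl sum.swap)
    also have "\<dots> = 2 * trace (R ** S_mat K L \<phi> X ** transpose R)"
      by (simp add: sum_cross_axis_inner_squared trace_conjugate_S_mat sum_distrib_left)
    finally show ?thesis .
  qed
  then show ?thesis
    using pos_semidef_S_mat main[of "mat 1"] by (simp add: transpose_mat)
qed

end
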